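(* In a six-dimensional Lorentzian vector space with metric $g_{\mu\nu}$ of signature $(-,+,+,+,+,+)$, let $v^\mu$ be a unit timelike vector ($v^\mu v_\mu=-1$), $F_{\mu\nu\rho}$ a three-form, $\Lambda_{\mu\nu\rho}=\Lambda^*_{\mu\nu\rho}$ a self-dual three-form, and $\mathcal V(I)$ a differentiable function. Put $E_{\mu\nu}=F_{\mu\nu\rho}v^\rho$, $B_{\mu\nu}=F^*_{\mu\nu\rho}v^\rho$, $\Lambda_{\mu\nu}=\Lambda_{\mu\nu\rho}v^\rho$, and suppose that the (INZ-type) equations $$B_{\mu\nu}=-\Lambda_{\mu\nu}-24\,\mathcal V_I(I(\Lambda))\left(4\Lambda_\mu{}^\sigma\Lambda_{\sigma\lambda}\Lambda^\lambda{}_\nu+\Lambda_{\mu\nu}\Lambda_{\rho\sigma}\Lambda^{\rho\sigma}\right),\qquad E_{\mu\nu}=-B_{\mu\nu}-2\Lambda_{\mu\nu}$$ hold. Then $$\Lambda_{\mu\nu\rho}=-F^+_{\mu\nu\rho},\qquad F^{-\,\mu\nu\rho}=24\,\mathcal V_I\,\Lambda^{\mu\nu}{}_\sigma M^{\sigma\rho},$$ and consequently $F$ satisfies the covariant, $v^\mu$-independent non-linear self-duality condition $$F^{-\,\mu\nu\rho}=-24\,\mathcal V_I(I(F^+))\,F^{+\,\mu\nu}{}_\sigma\, M(F^+)^{\sigma\rho}.$$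
   Context: The dual of a three-form is $F^{*\,\mu\nu\rho}=\frac1{3!}\boldsymbol\varepsilon^{\mu\nu\rho\lambda\sigma\kappa}F_{\lambda\sigma\kappa}$, with $\boldsymbol\varepsilon$ the Levi-Civita tensor normalized in an oriented orthonormal frame by $\boldsymbol\varepsilon^{012345}=-1$; it satisfies $F^{**}=F$. $F^\pm=\frac12(F\pm F^* )$. For a self-dual three-form $\Lambda$, $M(\Lambda)_\mu{}^\nu=\Lambda_{\mu\rho\lambda}\Lambda^{\nu\rho\lambda}$ and $I(\Lambda)=M_\mu{}^\nu M_\nu{}^\mu$; $M$ without argument means $M(\Lambda)$. $\mathcal V_I=d\mathcal V/dI$. *)

theory Defs
  imports "HOL-Analysis.Analysis"
begin

text \<open>
  A six-dimensional Lorentzian vector space is given in components with respect to an arbitrary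
  (not necessarily orthonormal) basis: vectors are elements of \<open>real^6\<close>, the metric
  is the matrix \<open>g $ \<mu> $ \<nu>\<close> of \<open>g\<^sub>\<mu>\<^sub>\<nu>\<close>, and the index values are
  \<open>0,\<dots>,5 :: 6\<close>.  Tensors are component functions; unless the name or a comment says
  otherwise, all their indices are covariant (lower).
\<close>

type_synonym tensor2 = "6 \<Rightarrow> 6 \<Rightarrow> real"
type_synonym tensor3 = "6 \<Rightarrow> 6 \<Rightarrow> 6 \<Rightarrow> real"

definition three_form :: "tensor3 \<Rightarrow> bool" where
  "three_form F \<longleftrightarrow> (\<forall>\<mu> \<nu> \<rho>. F \<mu> \<nu> \<rho> = - F \<nu> \<mu> \<rho> \<and> F \<mu> \<nu> \<rho> = - F \<mu> \<rho> \<nu>)"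

definition inner_g :: "real^6^6 \<Rightarrow> real^6 \<Rightarrow> real^6 \<Rightarrow> real" where
  "inner_g g x y = (\<Sum>\<mu>\<in>UNIV. \<Sum>\<nu>\<in>UNIV. g $ \<mu> $ \<nu> * x $ \<mu> * y $ \<nu>)"

definition minkowski :: "6 \<Rightarrow> 6 \<Rightarrow> real" where
  "minkowski a b = (if a = b then (if a = 0 then -1 else 1) else 0)"

definition orthonormal_frame :: "real^6^6 \<Rightarrow> (6 \<Rightarrow> real^6) \<Rightarrow> bool" where
  "orthonormal_frame g e \<longleftrightarrow> (\<forall>a b. inner_g g (e a) (e b) = minkowski a b)"

text \<open>
  \<open>g\<close> is symmetric of signature \<open>(-,+,+,+,+,+)\<close>, and the space is oriented by declaring
  its orthonormal frame \<open>e\<close> to be positively oriented.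
\<close>

definition oriented_lorentzian :: "real^6^6 \<Rightarrow> (6 \<Rightarrow> real^6) \<Rightarrow> bool" where
  "oriented_lorentzian g e \<longleftrightarrow> transpose g = g \<and> orthonormal_frame g e"

text \<open>
  The contravariant Levi-Civita tensor: the totally antisymmetric tensor whose component
  \<open>012345\<close> in the frame \<open>e\<close> is \<open>-1\<close>, transformed to the given basis.  It depends on
  \<open>e\<close> only through the orientation of \<open>e\<close>, since a change between equally oriented
  orthonormal frames has determinant \<open>1\<close>.
\<close>

definition levi_civita :: "(6 \<Rightarrow> real^6) \<Rightarrow> 6 \<Rightarrow> 6 \<Rightarrow> 6 \<Rightarrow> 6 \<Rightarrow> 6 \<Rightarrow> 6 \<Rightarrow> real" where
  "levi_civita e \<mu> \<nu> \<rho> \<tau> \<sigma> \<kappa> =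
     - (\<Sum>p | p permutes (UNIV :: 6 set). of_int (sign p) *
          (e (p 0) $ \<mu> * e (p 1) $ \<nu> * e (p 2) $ \<rho> * e (p 3) $ \<tau> * e (p 4) $ \<sigma> * e (p 5) $ \<kappa>))"

definition ginv :: "real^6^6 \<Rightarrow> 6 \<Rightarrow> 6 \<Rightarrow> real" where
  "ginv g \<mu> \<nu> = matrix_inv g $ \<mu> $ \<nu>"

definition lower3 :: "real^6^6 \<Rightarrow> tensor3 \<Rightarrow> tensor3" where
  "lower3 g T \<mu> \<nu> \<rho> = (\<Sum>\<alpha>\<in>UNIV. \<Sum>\<beta>\<in>UNIV. \<Sum>\<gamma>\<in>UNIV. g $ \<mu> $ \<alpha> * g $ \<nu> $ \<beta> * g $ \<rho> $ \<gamma> * T \<alpha> \<beta> \<gamma>)"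

definition raise3 :: "real^6^6 \<Rightarrow> tensor3 \<Rightarrow> tensor3" where
  "raise3 g T \<mu> \<nu> \<rho> = (\<Sum>\<alpha>\<in>UNIV. \<Sum>\<beta>\<in>UNIV. \<Sum>\<gamma>\<in>UNIV. ginv g \<mu> \<alpha> * ginv g \<nu> \<beta> * ginv g \<rho> \<gamma> * T \<alpha> \<beta> \<gamma>)"

text \<open>\<open>T\<^sup>\<mu>\<^sup>\<nu>\<^sub>\<rho>\<close>\<close>

definition raise3_12 :: "real^6^6 \<Rightarrow> tensor3 \<Rightarrow> tensor3" where
  "raise3_12 g T \<mu> \<nu> \<rho> = (\<Sum>\<alpha>\<in>UNIV. \<Sum>\<beta>\<in>UNIV. ginv g \<mu> \<alpha> * ginv g \<nu> \<beta> * T \<alpha> \<beta> \<rho>)"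

text \<open>\<open>T\<^sup>\<mu>\<^sub>\<nu>\<close>, \<open>T\<^sub>\<mu>\<^sup>\<nu>\<close> and \<open>T\<^sup>\<mu>\<^sup>\<nu>\<close>\<close>

definition raise2_1 :: "real^6^6 \<Rightarrow> tensor2 \<Rightarrow> tensor2" where
  "raise2_1 g T \<mu> \<nu> = (\<Sum>\<alpha>\<in>UNIV. ginv g \<mu> \<alpha> * T \<alpha> \<nu>)"

definition raise2_2 :: "real^6^6 \<Rightarrow> tensor2 \<Rightarrow> tensor2" where
  "raise2_2 g T \<mu> \<nu> = (\<Sum>\<beta>\<in>UNIV. ginv g \<nu> \<beta> * T \<mu> \<beta>)"

definition raise2 :: "real^6^6 \<Rightarrow> tensor2 \<Rightarrow> tensor2" where
  "raise2 g T = raise2_1 g (raise2_2 g T)"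

definition dual_up :: "(6 \<Rightarrow> real^6) \<Rightarrow> tensor3 \<Rightarrow> tensor3" where
  "dual_up e F \<mu> \<nu> \<rho> =
     1 / fact 3 * (\<Sum>\<tau>\<in>UNIV. \<Sum>\<sigma>\<in>UNIV. \<Sum>\<kappa>\<in>UNIV. levi_civita e \<mu> \<nu> \<rho> \<tau> \<sigma> \<kappa> * F \<tau> \<sigma> \<kappa>)"

definition dual :: "real^6^6 \<Rightarrow> (6 \<Rightarrow> real^6) \<Rightarrow> tensor3 \<Rightarrow> tensor3" where
  "dual g e F = lower3 g (dual_up e F)"

definition plus_part :: "real^6^6 \<Rightarrow> (6 \<Rightarrow> real^6) \<Rightarrow> tensor3 \<Rightarrow> tensor3" where
  "plus_part g e F \<mu> \<nu> \<rho> = 1 / 2 * (F \<mu> \<nu> \<rho> + dual g e F \<mu> \<nu> \<rho>)"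

definition minus_part :: "real^6^6 \<Rightarrow> (6 \<Rightarrow> real^6) \<Rightarrow> tensor3 \<Rightarrow> tensor3" where
  "minus_part g e F \<mu> \<nu> \<rho> = 1 / 2 * (F \<mu> \<nu> \<rho> - dual g e F \<mu> \<nu> \<rho>)"

definition contract_v :: "tensor3 \<Rightarrow> real^6 \<Rightarrow> tensor2" where
  "contract_v F v \<mu> \<nu> = (\<Sum>\<rho>\<in>UNIV. F \<mu> \<nu> \<rho> * v $ \<rho>)"

text \<open>\<open>M\<^sub>\<mu>\<^sup>\<nu>\<close> (first index lower, second upper), and \<open>M\<^sup>\<mu>\<^sup>\<nu>\<close>.\<close>

definition M_mixed :: "real^6^6 \<Rightarrow> tensor3 \<Rightarrow> tensor2" where
  "M_mixed g L \<mu> \<nu> = (\<Sum>\<rho>\<in>UNIV. \<Sum>\<tau>\<in>UNIV. L \<mu> \<rho> \<tau> * raise3 g L \<nu> \<rho> \<tau>)"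

definition M_up :: "real^6^6 \<Rightarrow> tensor3 \<Rightarrow> tensor2" where
  "M_up g L = raise2_1 g (M_mixed g L)"

definition I_inv :: "real^6^6 \<Rightarrow> tensor3 \<Rightarrow> real" where
  "I_inv g L = (\<Sum>\<mu>\<in>UNIV. \<Sum>\<nu>\<in>UNIV. M_mixed g L \<mu> \<nu> * M_mixed g L \<nu> \<mu>)"

text \<open>\<open>T\<^sub>\<mu>\<^sup>\<sigma> T\<^sub>\<sigma>\<^sub>\<tau> T\<^sup>\<tau>\<^sub>\<nu>\<close> and \<open>T\<^sub>\<rho>\<^sub>\<sigma> T\<^sup>\<rho>\<^sup>\<sigma>\<close>\<close>

definition cube2 :: "real^6^6 \<Rightarrow> tensor2 \<Rightarrow> tensor2" where
  "cube2 g T \<mu> \<nu> = (\<Sum>\<sigma>\<in>UNIV. \<Sum>\<tau>\<in>UNIV. raise2_2 g T \<mu> \<sigma> * T \<sigma> \<tau> * raise2_1 g T \<tau> \<nu>)"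

definition square2 :: "real^6^6 \<Rightarrow> tensor2 \<Rightarrow> real" where
  "square2 g T = (\<Sum>\<rho>\<in>UNIV. \<Sum>\<sigma>\<in>UNIV. T \<rho> \<sigma> * raise2 g T \<rho> \<sigma>)"

end

theory Submission
  imports Defs
begin

text \<open>
  In an orthonormal frame whose timelike vector is \<open>v\<close>, a self-dual or anti-self-dual
  three-form is determined by its electric part, the ten numbers \<open>T\<^sub>a\<^sub>b\<^sub>0\<close>.  Adding
  the two hypotheses on \<open>E\<close> and \<open>B\<close> shows that the self-dual forms \<open>F\<^sup>+\<close> and
  \<open>-\<Lambda>\<close> have the same electric part.  Subtracting them gives the electric part of
  \<open>F\<^sup>-\<close>; since \<open>M\<^sub>i\<^sub>j = \<Lambda>\<^sub>k\<^sub>l\<Lambda>\<^sup>k\<^sup>l \<delta>\<^sub>i\<^sub>j + 4 (\<Lambda>\<^sup>2)\<^sub>i\<^sub>j\<close> on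
  spatial indices, it equals \<open>24 V\<^sub>I\<close> times the electric part of
  \<open>\<Lambda>\<^sub>\<mu>\<^sub>\<nu>\<^sup>\<sigma>M\<^sub>\<sigma>\<^sub>\<rho>\<close>.  It remains to see that this tensor is totally antisymmetric and
  anti-self-dual, which is a family of cubic identities in the ten components of \<open>\<Lambda>\<^sub>\<mu>\<^sub>\<nu>\<close>.
\<close>

section \<open>Three-forms in an orthonormal frame\<close>

lemma UNIV_6: "(UNIV :: 6 set) = {0, 1, 2, 3, 4, 5}"
  by (rule sym, rule card_subset_eq) simp_all

lemma sum_6: "sum f (UNIV :: 6 set) = f 0 + f 1 + f 2 + f 3 + f 4 + f 5"
  unfolding UNIV_6 by (simp add: add.assoc)

lemma prod_6: "prod f (UNIV :: 6 set) = f 0 * f 1 * f 2 * f 3 * f 4 * f 5"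
  unfolding UNIV_6 by (simp add: mult.assoc)

lemma forall_6: "(\<forall>i::6. P i) \<longleftrightarrow> P 0 \<and> P 1 \<and> P 2 \<and> P 3 \<and> P 4 \<and> P 5"
proof -
  have "(\<forall>i::6. P i) \<longleftrightarrow> (\<forall>i\<in>UNIV. P i)" by simp
  then show ?thesis unfolding UNIV_6 by simp
qed

lemma Rep_6:
  "Rep_bit0 (0::6) = 0" "Rep_bit0 (1::6) = 1" "Rep_bit0 (2::6) = 2"
  "Rep_bit0 (3::6) = 3" "Rep_bit0 (4::6) = 4" "Rep_bit0 (5::6) = 5"
  by (simp_all add: bit0.Rep_0 bit0.Rep_1 bit0.Rep_numeral)

text \<open>These facts decide the ordering premises of \<open>eps_sort\<close> and
  \<open>three_form_sort\<close>, so that the simplifier can sort any concrete indices.\<close>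

lemma less_6:
  "\<not> (0::6) < 0" "(0::6) < 1" "(0::6) < 2" "(0::6) < 3" "(0::6) < 4" "(0::6) < 5"
  "\<not> (1::6) < 0" "\<not> (1::6) < 1" "(1::6) < 2" "(1::6) < 3" "(1::6) < 4" "(1::6) < 5"
  "\<not> (2::6) < 0" "\<not> (2::6) < 1" "\<not> (2::6) < 2" "(2::6) < 3" "(2::6) < 4" "(2::6) < 5"
  "\<not> (3::6) < 0" "\<not> (3::6) < 1" "\<not> (3::6) < 2" "\<not> (3::6) < 3" "(3::6) < 4" "(3::6) < 5"
  "\<not> (4::6) < 0" "\<not> (4::6) < 1" "\<not> (4::6) < 2" "\<not> (4::6) < 3" "\<not> (4::6) < 4" "(4::6) < 5"
  "\<not> (5::6) < 0" "\<not> (5::6) < 1" "\<not> (5::6) < 2" "\<not> (5::6) < 3" "\<not> (5::6) < 4" "\<not> (5::6) < 5"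
  by (simp_all add: less_bit0_def Rep_6)

text \<open>Taking the standard basis as frame gives the components of the Levi-Civita tensor in its
  own orthonormal frame: minus the permutation symbol.\<close>

definition eps :: "6 \<Rightarrow> 6 \<Rightarrow> 6 \<Rightarrow> 6 \<Rightarrow> 6 \<Rightarrow> 6 \<Rightarrow> real" where
  "eps = levi_civita (\<lambda>a. axis a 1)"

definition index6 :: "'a \<Rightarrow> 'a \<Rightarrow> 'a \<Rightarrow> 'a \<Rightarrow> 'a \<Rightarrow> 'a \<Rightarrow> 6 \<Rightarrow> 'a" where
  "index6 a b c d e f i =
    (if i = 0 then a else if i = 1 then b else if i = 2 then c
     else if i = 3 then d else if i = 4 then e else f)"

lemma index6_simps [simp]:
  "index6 a b c d e f 0 = a" "index6 a b c d e f 1 = b" "index6 a b c d e f 2 = c"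
  "index6 a b c d e f 3 = d" "index6 a b c d e f 4 = e" "index6 a b c d e f 5 = f"
  by (simp_all add: index6_def)

text \<open>The Leibniz formula. For a determinant, antisymmetry is a row swap and a change of frame
  is multiplicativity of \<open>det\<close>.\<close>

lemma levi_civita_det:
  "levi_civita x a b c d e f = - det (\<chi> i j. x j $ index6 a b c d e f i)"
  by (simp add: levi_civita_def det_def prod_6)

lemma det_swap_rows:
  fixes A :: "real^'n^'n"
  assumes "i \<noteq> j"
  shows "det (\<chi> k. A $ Transposition.transpose i j k) = - det A"
  using det_permute_rows[of "Transposition.transpose i j" A] assms
  by (simp add: permutes_swap_id sign_swap_id)

lemma eps_swap:
  "eps b a c d e f = - eps a b c d e f" "eps a c b d e f = - eps a b c d e f"
  "eps a b d c e f = - eps a b c d e f" "eps a b c e d f = - eps a b c d e f"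
  "eps a b c d f e = - eps a b c d e f"
proof -
  let ?A = "\<chi> i j. axis j 1 $ index6 a b c d e f i :: real^6^6"
  have *: "eps a' b' c' d' e' f' = - eps a b c d e f"
    if "i \<noteq> j" "index6 a' b' c' d' e' f' = index6 a b c d e f \<circ> Transposition.transpose i j"
    for i j a' b' c' d' e' f'
    using det_swap_rows[OF that(1), of ?A] that(2)
    by (simp add: eps_def levi_civita_det)
  show "eps b a c d e f = - eps a b c d e f"
    by (rule *[of 0 1]) (simp_all add: fun_eq_iff forall_6)
  show "eps a c b d e f = - eps a b c d e f"
    by (rule *[of 1 2]) (simp_all add: fun_eq_iff forall_6)
  show "eps a b d c e f = - eps a b c d e f"
    by (rule *[of 2 3]) (simp_all add: fun_eq_iff forall_6)
  show "eps a b c e d f = - eps a b c d e f"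
    by (rule *[of 3 4]) (simp_all add: fun_eq_iff forall_6)
  show "eps a b c d f e = - eps a b c d e f"
    by (rule *[of 4 5]) (simp_all add: fun_eq_iff forall_6)
qed

lemma eps_012345: "eps 0 1 2 3 4 5 = -1"
proof -
  have "(\<chi> i j. axis j 1 $ index6 0 1 2 3 4 5 i) = (mat 1 :: real^6^6)"
    by (auto simp: vec_eq_iff mat_def axis_def forall_6)
  then show ?thesis
    by (simp add: eps_def levi_civita_det)
qed

text \<open>The ordering premises keep these rules from looping in the simplifier, where together with
  \<open>eps_repeated\<close> they evaluate \<open>eps\<close> at concrete indices by bubble sort; likewise for
  three-forms below.\<close>

lemma eps_sort:
  "b < a \<Longrightarrow> eps a b c d e f = - eps b a c d e f"
  "c < b \<Longrightarrow> eps a b c d e f = - eps a c b d e f"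
  "d < c \<Longrightarrow> eps a b c d e f = - eps a b d c e f"
  "e < d \<Longrightarrow> eps a b c d e f = - eps a b c e d f"
  "f < e \<Longrightarrow> eps a b c d e f = - eps a b c d f e"
  by (rule eps_swap)+

lemma eps_repeated:
  "eps a a c d e f = 0" "eps a b b d e f = 0" "eps a b c c e f = 0"
  "eps a b c d d f = 0" "eps a b c d e e = 0"
  using eps_swap(1)[of a a c d e f] eps_swap(2)[of a b b d e f] eps_swap(3)[of a b c c e f]
    eps_swap(4)[of a b c d d f] eps_swap(5)[of a b c d e e] by auto

lemma three_form_sort:
  assumes "three_form T"
  shows "b < a \<Longrightarrow> T a b c = - T b a c" "c < b \<Longrightarrow> T a b c = - T a c b"
  using assms unfolding three_form_def by blast+

lemma three_form_repeated:
  assumes "three_form T"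
  shows "T a a c = 0" "T a b b = 0"
proof -
  have "T a a c = - T a a c" "T a b b = - T a b b" using assms unfolding three_form_def by blast+
  then show "T a a c = 0" "T a b b = 0" by auto
qed

abbreviation eta :: "6 \<Rightarrow> real" where "eta a \<equiv> minkowski a a"

text \<open>Lower frame indices throughout: \<open>eta\<close> lowers the indices of the contravariant \<open>eps\<close>.\<close>

definition hodge :: "tensor3 \<Rightarrow> tensor3" where
  "hodge T a b c = eta a * eta b * eta c / 6 * (\<Sum>d\<in>UNIV. \<Sum>e\<in>UNIV. \<Sum>f\<in>UNIV. eps a b c d e f * T d e f)"

lemma three_form_hodge: "three_form (hodge T)"
  unfolding three_form_def
proof (intro allI conjI)
  fix a b c
  show "hodge T a b c = - hodge T b a c"
    unfolding hodge_def eps_swap(1)[of b a c] by (simp add: sum_negf mult.commute)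
  show "hodge T a b c = - hodge T a c b"
    unfolding hodge_def eps_swap(2)[of a c b] by (simp add: sum_negf mult.commute)
qed

text \<open>Only the index triple complementary to \<open>a b c\<close> survives; its six orderings
  contribute equally and cancel the factor 1/6. The sign combines that of the permutation, the
  convention \<open>eps_012345\<close>, and a minus from \<open>eta 0\<close> if 0 is among
  \<open>a b c\<close>.\<close>

lemma hodge_components:
  assumes "three_form T"
  shows
    "hodge T 0 1 2 = T 3 4 5" "hodge T 0 1 3 = - T 2 4 5"
    "hodge T 0 1 4 = T 2 3 5" "hodge T 0 1 5 = - T 2 3 4"
    "hodge T 0 2 3 = T 1 4 5" "hodge T 0 2 4 = - T 1 3 5"
    "hodge T 0 2 5 = T 1 3 4" "hodge T 0 3 4 = T 1 2 5"
    "hodge T 0 3 5 = - T 1 2 4" "hodge T 0 4 5 = T 1 2 3"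
    "hodge T 1 2 3 = T 0 4 5" "hodge T 1 2 4 = - T 0 3 5"
    "hodge T 1 2 5 = T 0 3 4" "hodge T 1 3 4 = T 0 2 5"
    "hodge T 1 3 5 = - T 0 2 4" "hodge T 1 4 5 = T 0 2 3"
    "hodge T 2 3 4 = - T 0 1 5" "hodge T 2 3 5 = T 0 1 4"
    "hodge T 2 4 5 = - T 0 1 3" "hodge T 3 4 5 = T 0 1 2"
  by (simp_all add: hodge_def sum_6 eps_sort eps_repeated eps_012345 less_6 minkowski_def
      three_form_sort[OF assms] three_form_repeated[OF assms])

section \<open>The cubic tensor of a self-dual form\<close>

definition M_frame_comp :: "tensor3 \<Rightarrow> tensor2" where
  "M_frame_comp L a b = (\<Sum>c\<in>UNIV. \<Sum>d\<in>UNIV. eta c * eta d * (L a c d * L b c d))"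

text \<open>The frame form of \<Lambda>_{ab}^d M_{dc}. Nothing in the formula makes it antisymmetric
  in \<open>b\<close> and \<open>c\<close>; \<open>LM_self_dual\<close> derives that from
  self-duality.\<close>

definition LM :: "tensor3 \<Rightarrow> tensor3" where
  "LM L a b c = (\<Sum>d\<in>UNIV. eta d * (L a b d * M_frame_comp L d c))"

lemma eta_simps: "eta 0 = -1" "eta 1 = 1" "eta 2 = 1" "eta 3 = 1" "eta 4 = 1" "eta 5 = 1"
  by (simp_all add: minkowski_def)

lemma three_form_eqI:
  assumes S: "three_form S" and T: "three_form T"
    and "S 0 1 2 = T 0 1 2" "S 0 1 3 = T 0 1 3" "S 0 1 4 = T 0 1 4"
      "S 0 1 5 = T 0 1 5" "S 0 2 3 = T 0 2 3" "S 0 2 4 = T 0 2 4"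
      "S 0 2 5 = T 0 2 5" "S 0 3 4 = T 0 3 4" "S 0 3 5 = T 0 3 5"
      "S 0 4 5 = T 0 4 5" "S 1 2 3 = T 1 2 3" "S 1 2 4 = T 1 2 4"
      "S 1 2 5 = T 1 2 5" "S 1 3 4 = T 1 3 4" "S 1 3 5 = T 1 3 5"
      "S 1 4 5 = T 1 4 5" "S 2 3 4 = T 2 3 4" "S 2 3 5 = T 2 3 5"
      "S 2 4 5 = T 2 4 5" "S 3 4 5 = T 3 4 5"
  shows "S = T"
proof -
  have "\<forall>a b c. S a b c = T a b c"
    by (simp add: forall_6 assms(3-) three_form_sort[OF S] three_form_sort[OF T]
      three_form_repeated[OF S] three_form_repeated[OF T] less_6)
  then show ?thesis by (intro ext) blast
qed

lemma three_form_uminus: "three_form T \<Longrightarrow> three_form (\<lambda>a b c. - T a b c)"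
  unfolding three_form_def by metis

text \<open>Self-duality makes all of \<open>L\<close> a function of its ten electric components, so
  the entries of \<open>M\<close> are explicit quadratic forms and the claims become cubic
  polynomial identities, checked component by component. The third exhibits the bracket in the
  hypothesis on \<open>B\<close> as the electric part of \<open>LM L\<close>.\<close>

lemma LM_self_dual:
  assumes L: "three_form L" and sd: "hodge L = L"
  shows "three_form (LM L)" "hodge (LM L) = (\<lambda>a b c. - LM L a b c)"
    "LM L a b 0 = 4 * (\<Sum>c\<in>UNIV. \<Sum>d\<in>UNIV. eta c * eta d * (L a c 0 * L c d 0 * L d b 0))
     + L a b 0 * (\<Sum>c\<in>UNIV. \<Sum>d\<in>UNIV. eta c * eta d * (L c d 0)\<^sup>2)"
proof -
  define l12 where "l12 = L 0 1 2"
  define l13 where "l13 = L 0 1 3"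
  define l14 where "l14 = L 0 1 4"
  define l15 where "l15 = L 0 1 5"
  define l23 where "l23 = L 0 2 3"
  define l24 where "l24 = L 0 2 4"
  define l25 where "l25 = L 0 2 5"
  define l34 where "l34 = L 0 3 4"
  define l35 where "l35 = L 0 3 5"
  define l45 where "l45 = L 0 4 5"
  note electric =
    l12_def[symmetric] l13_def[symmetric] l14_def[symmetric] l15_def[symmetric]
    l23_def[symmetric] l24_def[symmetric] l25_def[symmetric] l34_def[symmetric]
    l35_def[symmetric] l45_def[symmetric]
  have magnetic:
    "L 1 2 3 = l45" "L 1 2 4 = - l35"
    "L 1 2 5 = l34" "L 1 3 4 = l25"
    "L 1 3 5 = - l24" "L 1 4 5 = l23"
    "L 2 3 4 = - l15" "L 2 3 5 = l14"
    "L 2 4 5 = - l13" "L 3 4 5 = l12"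
    using hodge_components[OF L] unfolding sd electric by simp_all
  note L_rules = electric magnetic three_form_sort[OF L] three_form_repeated[OF L] less_6
  \<comment> \<open>The full contraction \<Lambda>_{kl} \<Lambda>^{kl}; the 2 counts both orders of
    each index pair. A spatial diagonal entry of \<open>M\<close> is \<open>s\<close> plus four
    times that of \<Lambda> squared, which is minus a sum of squares.\<close>
  define s where "s = 2 * (l12^2 + l13^2 + l14^2 + l15^2 + l23^2 + l24^2 + l25^2 + l34^2 + l35^2 + l45^2)"
  have M00: "M_frame_comp L 0 0 = s"
    by (simp add: M_frame_comp_def sum_6 eta_simps L_rules s_def power2_eq_square)
  have M_sym: "M_frame_comp L a b = M_frame_comp L b a" for a b
    by (simp add: M_frame_comp_def mult.commute)
  have M_diag:
    "M_frame_comp L 1 1 = s - 4 * (l12^2 + l13^2 + l14^2 + l15^2)"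
    "M_frame_comp L 2 2 = s - 4 * (l12^2 + l23^2 + l24^2 + l25^2)"
    "M_frame_comp L 3 3 = s - 4 * (l13^2 + l23^2 + l34^2 + l35^2)"
    "M_frame_comp L 4 4 = s - 4 * (l14^2 + l24^2 + l34^2 + l45^2)"
    "M_frame_comp L 5 5 = s - 4 * (l15^2 + l25^2 + l35^2 + l45^2)"
    by (simp_all add: M_frame_comp_def sum_6 eta_simps L_rules s_def power2_eq_square)
  have M_off:
    "M_frame_comp L 0 1 = 4 * l23 * l45 - 4 * l24 * l35 + 4 * l25 * l34"
    "M_frame_comp L 0 2 = - 4 * l13 * l45 + 4 * l14 * l35 - 4 * l15 * l34"
    "M_frame_comp L 0 3 = 4 * l12 * l45 - 4 * l14 * l25 + 4 * l15 * l24"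
    "M_frame_comp L 0 4 = - 4 * l12 * l35 + 4 * l13 * l25 - 4 * l15 * l23"
    "M_frame_comp L 0 5 = 4 * l12 * l34 - 4 * l13 * l24 + 4 * l14 * l23"
    "M_frame_comp L 1 2 = - 4 * l13 * l23 - 4 * l14 * l24 - 4 * l15 * l25"
    "M_frame_comp L 1 3 = 4 * l12 * l23 - 4 * l14 * l34 - 4 * l15 * l35"
    "M_frame_comp L 1 4 = 4 * l12 * l24 + 4 * l13 * l34 - 4 * l15 * l45"
    "M_frame_comp L 1 5 = 4 * l12 * l25 + 4 * l13 * l35 + 4 * l14 * l45"
    "M_frame_comp L 2 3 = - 4 * l12 * l13 - 4 * l24 * l34 - 4 * l25 * l35"
    "M_frame_comp L 2 4 = - 4 * l12 * l14 + 4 * l23 * l34 - 4 * l25 * l45"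
    "M_frame_comp L 2 5 = - 4 * l12 * l15 + 4 * l23 * l35 + 4 * l24 * l45"
    "M_frame_comp L 3 4 = - 4 * l13 * l14 - 4 * l23 * l24 - 4 * l35 * l45"
    "M_frame_comp L 3 5 = - 4 * l13 * l15 - 4 * l23 * l25 + 4 * l34 * l45"
    "M_frame_comp L 4 5 = - 4 * l14 * l15 - 4 * l24 * l25 - 4 * l34 * l35"
    by (simp_all add: M_frame_comp_def sum_6 eta_simps L_rules)
  note M_rules = M00 M_diag M_off M_off[THEN trans[OF M_sym]]
  \<comment> \<open>Antisymmetry in the last pair is the substantial half, a polynomial identity for
    each index triple; in the first pair it is inherited from \<open>L\<close>.\<close>
  have "\<forall>a b c. LM L a b c = - LM L a c b"
    unfolding forall_6 LM_def sum_6 eta_simps M_rules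
    by (intro conjI; simp add: L_rules s_def power2_eq_square algebra_simps)
  moreover have "LM L a b c = - LM L b a c" for a b c
  proof -
    have "L a b d = - L b a d" for d using L unfolding three_form_def by blast
    then show ?thesis by (simp add: LM_def sum_negf)
  qed
  ultimately show tf: "three_form (LM L)"
    unfolding three_form_def by blast
  show "hodge (LM L) = (\<lambda>a b c. - LM L a b c)"
    by (rule three_form_eqI[OF three_form_hodge three_form_uminus[OF tf]])
      (simp_all add: hodge_components[OF tf] LM_def sum_6 eta_simps M_rules L_rules s_def
        power2_eq_square algebra_simps)
  have "\<forall>a b. LM L a b 0 = 4 * (\<Sum>c\<in>UNIV. \<Sum>d\<in>UNIV. eta c * eta d * (L a c 0 * L c d 0 * L d b 0))
     + L a b 0 * (\<Sum>c\<in>UNIV. \<Sum>d\<in>UNIV. eta c * eta d * (L c d 0)\<^sup>2)"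
    unfolding forall_6 LM_def sum_6 eta_simps M_rules
    by (intro conjI; simp add: L_rules s_def power2_eq_square algebra_simps)
  then show "LM L a b 0 = 4 * (\<Sum>c\<in>UNIV. \<Sum>d\<in>UNIV. eta c * eta d * (L a c 0 * L c d 0 * L d b 0))
     + L a b 0 * (\<Sum>c\<in>UNIV. \<Sum>d\<in>UNIV. eta c * eta d * (L c d 0)\<^sup>2)" for a b
    by blast
qed

section \<open>Components with respect to a frame\<close>

text \<open>One linear operation for two uses: with frame vectors as \<open>C\<close> it evaluates
  an index in the frame, with the metric as \<open>C\<close> it lowers an index.\<close>

definition contract :: "(6 \<Rightarrow> 6 \<Rightarrow> real) \<Rightarrow> (6 \<Rightarrow> real) \<Rightarrow> 6 \<Rightarrow> real" where
  "contract C w i = (\<Sum>j\<in>UNIV. C i j * w j)"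

lemma contract_sum: "contract C (\<lambda>j. \<Sum>k\<in>K. w k j) i = (\<Sum>k\<in>K. contract C (w k) i)"
  unfolding contract_def sum_distrib_left by (rule sum.swap)

lemma contract_cmult: "contract C (\<lambda>j. k * w j) i = k * contract C w i"
  unfolding contract_def by (simp add: sum_distrib_left mult.left_commute)

lemma contract_add: "contract C (\<lambda>j. w j + w' j) i = contract C w i + contract C w' i"
  by (simp add: contract_def distrib_left sum.distrib)

lemma contract_uminus: "contract C (\<lambda>j. - w j) i = - contract C w i"
  using contract_cmult[of C "-1" w i] by simp

lemma contract_swap: "contract C (\<lambda>i. contract D (\<lambda>j. w i j) b) a = contract D (\<lambda>j. contract C (\<lambda>i. w i j) a) b"
  unfolding contract_def sum_distrib_left by (subst sum.swap) (simp add: mult.left_commute)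

definition frame_comp :: "(6 \<Rightarrow> real^6) \<Rightarrow> (6 \<Rightarrow> real) \<Rightarrow> 6 \<Rightarrow> real" where
  "frame_comp e = contract (\<lambda>a \<mu>. e a $ \<mu>)"

definition comp2 :: "(6 \<Rightarrow> real^6) \<Rightarrow> tensor2 \<Rightarrow> tensor2" where
  "comp2 e T a b = frame_comp e (\<lambda>\<mu>. frame_comp e (T \<mu>) b) a"

definition comp3 :: "(6 \<Rightarrow> real^6) \<Rightarrow> tensor3 \<Rightarrow> tensor3" where
  "comp3 e T a b c = frame_comp e (\<lambda>\<mu>. comp2 e (T \<mu>) b c) a"

lemmas frame_comp_sum = contract_sum[where C = "\<lambda>a \<mu>. e a $ \<mu>" for e, folded frame_comp_def]
lemmas frame_comp_cmult = contract_cmult[where C = "\<lambda>a \<mu>. e a $ \<mu>" for e, folded frame_comp_def]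
lemmas frame_comp_add = contract_add[where C = "\<lambda>a \<mu>. e a $ \<mu>" for e, folded frame_comp_def]
lemmas frame_comp_uminus = contract_uminus[where C = "\<lambda>a \<mu>. e a $ \<mu>" for e, folded frame_comp_def]

lemma frame_comp_swap:
  "frame_comp e (\<lambda>\<mu>. frame_comp e (\<lambda>\<nu>. w \<mu> \<nu>) b) a = frame_comp e (\<lambda>\<nu>. frame_comp e (\<lambda>\<mu>. w \<mu> \<nu>) a) b"
  unfolding frame_comp_def by (rule contract_swap)

lemma sum_frame: "(\<Sum>\<mu>\<in>UNIV. (\<Sum>a\<in>UNIV. e a $ \<mu> * k a) * w \<mu>) = (\<Sum>a\<in>UNIV. k a * frame_comp e w a)"
  unfolding frame_comp_def contract_def sum_distrib_left sum_distrib_right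
  by (subst sum.swap) (simp add: mult_ac)

section \<open>The metric, its determinant and its inverse in an orthonormal frame\<close>

abbreviation frame_matrix :: "(6 \<Rightarrow> real^6) \<Rightarrow> real^6^6" where
  "frame_matrix e \<equiv> \<chi> a. e a"

definition minkowski_matrix :: "real^6^6" where
  "minkowski_matrix = (\<chi> a b. minkowski a b)"

lemma minkowski_matrix_square: "minkowski_matrix ** minkowski_matrix = mat 1"
  unfolding vec_eq_iff forall_6
  by (simp add: matrix_matrix_mult_def minkowski_matrix_def minkowski_def mat_def sum_6)

lemma orthonormal_frame_matrix:
  assumes "orthonormal_frame g e"
  shows "frame_matrix e ** g ** transpose (frame_matrix e) = minkowski_matrix"
proof -
  have "(frame_matrix e ** g ** transpose (frame_matrix e)) $ a $ b = inner_g g (e a) (e b)" for a b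
    unfolding matrix_matrix_mult_def transpose_def inner_g_def vec_lambda_beta sum_distrib_right
    by (subst sum.swap) (simp add: mult_ac)
  with assms show ?thesis
    by (simp add: vec_eq_iff orthonormal_frame_def minkowski_matrix_def)
qed

text \<open>Determinants of \<open>E g E^T = eta\<close>, together with \<open>eta^2 = 1\<close>.
  The first claim fixes \<open>det\<close> up to sign among the orthonormal frames of
  \<open>g\<close>, as comparing orientations requires; the second makes the frame a basis.\<close>

lemma orthonormal_frame_det:
  assumes "orthonormal_frame g e"
  shows "(det (frame_matrix e))\<^sup>2 * det g = det minkowski_matrix" "det (frame_matrix e) \<noteq> 0" "det g \<noteq> 0"
proof -
  show *: "(det (frame_matrix e))\<^sup>2 * det g = det minkowski_matrix"
    using arg_cong[OF orthonormal_frame_matrix[OF assms], of det]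
    by (simp add: det_mul power2_eq_square mult_ac)
  have "det minkowski_matrix * det minkowski_matrix = 1"
    using arg_cong[OF minkowski_matrix_square, of det] by (simp add: det_mul)
  with * show "det (frame_matrix e) \<noteq> 0" "det g \<noteq> 0" by auto
qed

lemma matrix_inv_eqI:
  fixes A B :: "real^'n^'n"
  assumes AB: "A ** B = mat 1"
  shows "matrix_inv A = B"
  unfolding matrix_inv_def
proof (rule some_equality)
  show "A ** B = mat 1 \<and> B ** A = mat 1"
    using AB matrix_left_right_inverse by blast
  show "C = B" if "A ** C = mat 1 \<and> C ** A = mat 1" for C
    using that AB by (metis matrix_mul_assoc matrix_mul_lid matrix_mul_rid)
qed

text \<open>The completeness relation. \<open>E g E^T = eta\<close> and \<open>eta^2 = 1\<close>
  exhibit \<open>g E^T eta\<close> as inverse of \<open>E\<close>; a one-sided inverse of a square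
  matrix is two-sided, so \<open>E\<close> moves to the right end and \<open>E^T eta E\<close> is
  the inverse of \<open>g\<close>.\<close>

lemma ginv_frame:
  assumes "orthonormal_frame g e"
  shows "ginv g \<mu> \<nu> = (\<Sum>a\<in>UNIV. eta a * (e a $ \<mu> * e a $ \<nu>))"
proof -
  let ?E = "frame_matrix e"
  let ?K = "transpose ?E ** minkowski_matrix ** ?E"
  have "?E ** (g ** transpose ?E ** minkowski_matrix) = mat 1"
    using orthonormal_frame_matrix[OF assms] minkowski_matrix_square
    by (simp add: matrix_mul_assoc)
  then have "(g ** transpose ?E ** minkowski_matrix) ** ?E = mat 1"
    using matrix_left_right_inverse by blast
  then have "g ** ?K = mat 1"
    by (simp add: matrix_mul_assoc)
  then have "matrix_inv g = ?K"
    by (rule matrix_inv_eqI)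
  moreover have "?K $ \<mu> $ \<nu> = (\<Sum>a\<in>UNIV. eta a * (e a $ \<mu> * e a $ \<nu>))"
    by (simp add: matrix_matrix_mult_def transpose_def minkowski_matrix_def minkowski_def sum_6 mult.assoc)
  ultimately show ?thesis by (simp add: ginv_def)
qed

text \<open>Every raised index in the definitions is a sum of this kind, so raising becomes
  multiplication of frame components by \<open>eta\<close>.\<close>

lemma sum_ginv:
  assumes "orthonormal_frame g e"
  shows "(\<Sum>\<alpha>\<in>UNIV. ginv g \<mu> \<alpha> * w \<alpha>) = (\<Sum>a\<in>UNIV. e a $ \<mu> * (eta a * frame_comp e w a))"
  unfolding ginv_frame[OF assms] frame_comp_def contract_def sum_distrib_left sum_distrib_right
  by (subst sum.swap) (simp add: mult_ac)

lemma frame_comp_inject: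
  assumes "det (frame_matrix e) \<noteq> 0" and "\<And>a. frame_comp e w a = frame_comp e w' a"
  shows "w = w'"
proof -
  have "frame_matrix e *v (\<chi> \<mu>. w \<mu>) = frame_matrix e *v (\<chi> \<mu>. w' \<mu>)"
    using assms(2) by (simp add: vec_eq_iff matrix_vector_mult_def frame_comp_def contract_def)
  moreover have "inj ((*v) (frame_matrix e))"
    using assms(1) by (simp add: inj_matrix_vector_mult invertible_det_nz)
  ultimately have "(\<chi> \<mu>. w \<mu>) = (\<chi> \<mu>. w' \<mu>)"
    by (meson injD)
  then show ?thesis
    by (simp add: vec_eq_iff fun_eq_iff)
qed

text \<open>Brings identities from the frame back to the given basis: the frame vectors are linearly
  independent, so the slots can be peeled off one at a time.\<close>

lemma comp3_inject:
  assumes e: "det (frame_matrix e) \<noteq> 0" and "comp3 e T = comp3 e T'"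
  shows "T = T'"
proof -
  have "(\<lambda>\<mu>. comp2 e (T \<mu>) b c) = (\<lambda>\<mu>. comp2 e (T' \<mu>) b c)" for b c
    by (rule frame_comp_inject[OF e]) (use assms(2) in \<open>simp add: comp3_def fun_eq_iff\<close>)
  then have "(\<lambda>\<nu>. frame_comp e (T \<mu> \<nu>) c) = (\<lambda>\<nu>. frame_comp e (T' \<mu> \<nu>) c)" for \<mu> c
    by (intro frame_comp_inject[OF e]) (simp add: comp2_def fun_eq_iff)
  then have "T \<mu> \<nu> = T' \<mu> \<nu>" for \<mu> \<nu>
    by (intro frame_comp_inject[OF e]) (simp add: fun_eq_iff)
  then show ?thesis by (intro ext) simp
qed

lemma comp3_lin:
  "comp3 e (\<lambda>\<mu> \<nu> \<rho>. T \<mu> \<nu> \<rho> + T' \<mu> \<nu> \<rho>) a b c = comp3 e T a b c + comp3 e T' a b c"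
  "comp3 e (\<lambda>\<mu> \<nu> \<rho>. - T \<mu> \<nu> \<rho>) a b c = - comp3 e T a b c"
  "comp3 e (\<lambda>\<mu> \<nu> \<rho>. k * T \<mu> \<nu> \<rho>) a b c = k * comp3 e T a b c"
  by (simp_all add: comp3_def comp2_def frame_comp_add frame_comp_uminus frame_comp_cmult)

lemma three_form_comp3:
  assumes "three_form T"
  shows "three_form (comp3 e T)"
  unfolding three_form_def
proof (intro allI conjI)
  fix a b c
  have 1: "T = (\<lambda>\<mu> \<nu> \<rho>. - T \<nu> \<mu> \<rho>)" "T = (\<lambda>\<mu> \<nu> \<rho>. - T \<mu> \<rho> \<nu>)"
    by (intro ext, use assms in \<open>unfold three_form_def, blast\<close>)+
  show "comp3 e T a b c = - comp3 e T b a c"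
    by (subst 1(1), simp only: comp3_lin) (simp add: comp3_def comp2_def frame_comp_swap[of e _ b a])
  show "comp3 e T a b c = - comp3 e T a c b"
    by (subst 1(2), simp only: comp3_lin) (simp add: comp3_def comp2_def frame_comp_swap[of e _ c b])
qed

section \<open>Raised tensors and contractions expanded in the frame\<close>

lemma raise3_frame:
  assumes "orthonormal_frame g e"
  shows "raise3 g T \<mu> \<nu> \<rho> = (\<Sum>a\<in>UNIV. e a $ \<mu> * (eta a * (\<Sum>b\<in>UNIV. e b $ \<nu> * (eta b *
     (\<Sum>c\<in>UNIV. e c $ \<rho> * (eta c * comp3 e T a b c))))))"
proof -
  have "raise3 g T \<mu> \<nu> \<rho> = (\<Sum>\<alpha>\<in>UNIV. ginv g \<mu> \<alpha> * (\<Sum>\<beta>\<in>UNIV. ginv g \<nu> \<beta> * (\<Sum>\<gamma>\<in>UNIV. ginv g \<rho> \<gamma> * T \<alpha> \<beta> \<gamma>)))"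
    by (simp add: raise3_def sum_distrib_left mult.assoc)
  then show ?thesis
    by (simp add: sum_ginv[OF assms] frame_comp_sum frame_comp_cmult comp3_def comp2_def)
qed

lemma raise3_12_frame:
  assumes "orthonormal_frame g e"
  shows "raise3_12 g T \<mu> \<nu> \<rho> = (\<Sum>a\<in>UNIV. e a $ \<mu> * (eta a * (\<Sum>b\<in>UNIV. e b $ \<nu> * (eta b *
     comp2 e (\<lambda>\<alpha> \<beta>. T \<alpha> \<beta> \<rho>) a b))))"
proof -
  have "raise3_12 g T \<mu> \<nu> \<rho> = (\<Sum>\<alpha>\<in>UNIV. ginv g \<mu> \<alpha> * (\<Sum>\<beta>\<in>UNIV. ginv g \<nu> \<beta> * T \<alpha> \<beta> \<rho>))"
    by (simp add: raise3_12_def sum_distrib_left mult.assoc)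
  then show ?thesis
    by (simp add: sum_ginv[OF assms] frame_comp_sum frame_comp_cmult comp2_def)
qed

text \<open>With \<open>v\<close> as frame vector 0, this turns \<open>E\<close>, \<open>B\<close>
  and \<open>l\<close> into electric components \<open>T a b 0\<close>.\<close>

lemma comp2_contract_v: "comp2 e (contract_v T (e c)) a b = comp3 e T a b c"
proof -
  have "contract_v T (e c) \<mu> \<nu> = frame_comp e (T \<mu> \<nu>) c" for \<mu> \<nu>
    by (simp add: contract_v_def frame_comp_def contract_def mult.commute)
  then have "contract_v T (e c) = (\<lambda>\<mu> \<nu>. frame_comp e (T \<mu> \<nu>) c)"
    by blast
  then show ?thesis
    by (simp add: comp2_def comp3_def)
qed

lemma sum_swap_22:
  "(\<Sum>i\<in>A. \<Sum>j\<in>B. \<Sum>k\<in>C. \<Sum>l\<in>D. f i j k l) = (\<Sum>k\<in>C. \<Sum>l\<in>D. \<Sum>i\<in>A. \<Sum>j\<in>B. f i j k l)"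
proof -
  have "(\<Sum>i\<in>A. \<Sum>j\<in>B. \<Sum>k\<in>C. \<Sum>l\<in>D. f i j k l) = (\<Sum>i\<in>A. \<Sum>k\<in>C. \<Sum>l\<in>D. \<Sum>j\<in>B. f i j k l)"
    by (subst sum.swap) (intro sum.cong refl sum.swap)
  also have "\<dots> = (\<Sum>k\<in>C. \<Sum>l\<in>D. \<Sum>i\<in>A. \<Sum>j\<in>B. f i j k l)"
    by (subst sum.swap) (intro sum.cong refl sum.swap)
  finally show ?thesis .
qed

lemma sum_swap_31:
  "(\<Sum>i\<in>A. \<Sum>j\<in>B. \<Sum>k\<in>C. \<Sum>l\<in>D. f i j k l) = (\<Sum>l\<in>D. \<Sum>i\<in>A. \<Sum>j\<in>B. \<Sum>k\<in>C. f i j k l)"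
  by (simp only: sum.swap[of _ D])

lemma sum_frame2:
  "(\<Sum>\<mu>\<in>UNIV. \<Sum>\<nu>\<in>UNIV. T \<mu> \<nu> * (\<Sum>a\<in>UNIV. e a $ \<mu> * (\<Sum>b\<in>UNIV. e b $ \<nu> * k a b)))
    = (\<Sum>a\<in>UNIV. \<Sum>b\<in>UNIV. k a b * comp2 e T a b)"
  unfolding comp2_def frame_comp_def contract_def sum_distrib_left
  by (subst sum_swap_22) (simp add: mult_ac)

lemma M_up_frame:
  assumes "orthonormal_frame g e"
  shows "M_up g L \<sigma> \<rho> = (\<Sum>d\<in>UNIV. e d $ \<sigma> * (eta d *
    (\<Sum>c\<in>UNIV. e c $ \<rho> * (eta c * M_frame_comp (comp3 e L) d c))))"
proof -
  have M: "M_mixed g L \<alpha> \<rho> = (\<Sum>c\<in>UNIV. e c $ \<rho> * (eta c *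
      (\<Sum>a\<in>UNIV. \<Sum>b\<in>UNIV. (eta a * eta b * comp3 e L c a b) * comp2 e (L \<alpha>) a b)))" for \<alpha>
  proof -
    have "M_mixed g L \<alpha> \<rho> = (\<Sum>c\<in>UNIV. e c $ \<rho> * (eta c * (\<Sum>\<mu>\<in>UNIV. \<Sum>\<nu>\<in>UNIV. L \<alpha> \<mu> \<nu> *
      (\<Sum>a\<in>UNIV. e a $ \<mu> * (\<Sum>b\<in>UNIV. e b $ \<nu> * (eta a * eta b * comp3 e L c a b))))))"
      unfolding M_mixed_def raise3_frame[OF assms] sum_distrib_left
      by (subst sum.swap[of _ UNIV UNIV], subst (2) sum.swap) (simp add: mult_ac)
    then show ?thesis by (simp only: sum_frame2)
  qed
  have "frame_comp e (\<lambda>\<alpha>. M_mixed g L \<alpha> \<rho>) d = (\<Sum>c\<in>UNIV. e c $ \<rho> * (eta c * M_frame_comp (comp3 e L) d c))" for d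
    unfolding M frame_comp_sum frame_comp_cmult
    by (simp add: M_frame_comp_def comp3_def mult_ac)
  then show ?thesis
    by (simp add: M_up_def raise2_1_def sum_ginv[OF assms])
qed

text \<open>The same outer expansion as in \<open>raise3_frame\<close>, with \<open>LM\<close> in
  place of the components of \<open>T\<close>; comparing the two reduces the formula for F^- to an
  equation between frame components.\<close>

lemma L_M_up_frame:
  assumes "orthonormal_frame g e"
  shows "(\<Sum>\<sigma>\<in>UNIV. raise3_12 g L \<mu> \<nu> \<sigma> * M_up g L \<sigma> \<rho>) =
    (\<Sum>a\<in>UNIV. e a $ \<mu> * (eta a * (\<Sum>b\<in>UNIV. e b $ \<nu> * (eta b *
     (\<Sum>c\<in>UNIV. e c $ \<rho> * (eta c * LM (comp3 e L) a b c))))))"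
proof -
  have comp: "frame_comp e (\<lambda>\<sigma>. comp2 e (\<lambda>\<alpha> \<beta>. L \<alpha> \<beta> \<sigma>) a b) d = comp3 e L a b d" for a b d
    unfolding comp2_def comp3_def
    by (subst frame_comp_swap, subst (2) frame_comp_swap) (rule refl)
  have "(\<Sum>\<sigma>\<in>UNIV. raise3_12 g L \<mu> \<nu> \<sigma> * M_up g L \<sigma> \<rho>) =
    (\<Sum>d\<in>UNIV. (eta d * (\<Sum>c\<in>UNIV. e c $ \<rho> * (eta c * M_frame_comp (comp3 e L) d c))) *
      frame_comp e (raise3_12 g L \<mu> \<nu>) d)"
    unfolding M_up_frame[OF assms] by (subst sum_frame[symmetric]) (simp add: mult.commute)
  also have "\<dots> = (\<Sum>d\<in>UNIV. (eta d * (\<Sum>c\<in>UNIV. e c $ \<rho> * (eta c * M_frame_comp (comp3 e L) d c))) *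
      (\<Sum>a\<in>UNIV. e a $ \<mu> * (eta a * (\<Sum>b\<in>UNIV. e b $ \<nu> * (eta b * comp3 e L a b d)))))"
    unfolding raise3_12_frame[OF assms] frame_comp_sum frame_comp_cmult comp by (rule refl)
  also have "\<dots> = (\<Sum>a\<in>UNIV. e a $ \<mu> * (eta a * (\<Sum>b\<in>UNIV. e b $ \<nu> * (eta b *
     (\<Sum>c\<in>UNIV. e c $ \<rho> * (eta c * LM (comp3 e L) a b c))))))"
    unfolding LM_def sum_distrib_left sum_distrib_right
    by (subst sum_swap_31[symmetric]) (simp add: mult_ac)
  finally show ?thesis .
qed

lemma comp2_sum: "comp2 e (\<lambda>\<mu> \<nu>. \<Sum>k\<in>K. T k \<mu> \<nu>) a b = (\<Sum>k\<in>K. comp2 e (T k) a b)"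
  by (simp add: comp2_def frame_comp_sum)

lemma comp2_add: "comp2 e (\<lambda>\<mu> \<nu>. S \<mu> \<nu> + T \<mu> \<nu>) a b = comp2 e S a b + comp2 e T a b"
  by (simp add: comp2_def frame_comp_add)

lemma comp2_cmult: "comp2 e (\<lambda>\<mu> \<nu>. k * T \<mu> \<nu>) a b = k * comp2 e T a b"
  by (simp add: comp2_def frame_comp_cmult)

lemma comp2_mult: "comp2 e (\<lambda>\<mu> \<nu>. x \<mu> * y \<nu>) a b = frame_comp e x a * frame_comp e y b"
  by (simp add: comp2_def frame_comp_cmult mult.commute[of _ "frame_comp e y b"])

lemma cube2_frame:
  assumes "orthonormal_frame g e"
  shows "comp2 e (cube2 g T) a b = (\<Sum>c\<in>UNIV. \<Sum>d\<in>UNIV. eta c * eta d *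
    (comp2 e T a c * comp2 e T c d * comp2 e T d b))"
proof -
  have "cube2 g T \<mu> \<nu> = (\<Sum>\<sigma>\<in>UNIV. \<Sum>\<tau>\<in>UNIV. T \<sigma> \<tau> * (\<Sum>c\<in>UNIV. e c $ \<sigma> * (\<Sum>d\<in>UNIV. e d $ \<tau> *
     (eta c * frame_comp e (T \<mu>) c * (eta d * frame_comp e (\<lambda>\<alpha>. T \<alpha> \<nu>) d)))))" for \<mu> \<nu>
    unfolding cube2_def raise2_1_def raise2_2_def sum_ginv[OF assms] sum_distrib_left sum_distrib_right
    by (rule sum.cong[OF refl], rule sum.cong[OF refl], subst sum.swap) (simp add: mult_ac)
  then have "cube2 g T = (\<lambda>\<mu> \<nu>. \<Sum>c\<in>UNIV. \<Sum>d\<in>UNIV. (eta c * eta d * comp2 e T c d) *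
     (frame_comp e (T \<mu>) c * frame_comp e (\<lambda>\<alpha>. T \<alpha> \<nu>) d))"
    unfolding sum_frame2 by (simp add: mult_ac fun_eq_iff)
  then have "comp2 e (cube2 g T) a b = comp2 e (\<lambda>\<mu> \<nu>. \<Sum>c\<in>UNIV. \<Sum>d\<in>UNIV. (eta c * eta d * comp2 e T c d) *
     (frame_comp e (T \<mu>) c * frame_comp e (\<lambda>\<alpha>. T \<alpha> \<nu>) d)) a b"
    by (rule arg_cong)
  also have "\<dots> = (\<Sum>c\<in>UNIV. \<Sum>d\<in>UNIV. (eta c * eta d * comp2 e T c d) *
     (comp2 e T d b * comp2 e T a c))"
  proof -
    have "frame_comp e (\<lambda>\<nu>. frame_comp e (\<lambda>\<alpha>. T \<alpha> \<nu>) d) b = comp2 e T d b" for d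
      unfolding comp2_def by (rule frame_comp_swap)
    then show ?thesis
      by (simp add: comp2_sum comp2_cmult comp2_mult mult.commute flip: comp2_def)
  qed
  finally show ?thesis by (simp add: mult_ac)
qed

lemma square2_frame:
  assumes "orthonormal_frame g e"
  shows "square2 g T = (\<Sum>c\<in>UNIV. \<Sum>d\<in>UNIV. eta c * eta d * (comp2 e T c d)\<^sup>2)"
proof -
  have raise2: "raise2 g T \<rho> \<sigma> = (\<Sum>c\<in>UNIV. e c $ \<rho> * (\<Sum>d\<in>UNIV. e d $ \<sigma> * (eta c * eta d * comp2 e T c d)))" for \<rho> \<sigma>
    unfolding raise2_def raise2_1_def raise2_2_def sum_ginv[OF assms] frame_comp_sum frame_comp_cmult comp2_def
    by (simp add: sum_distrib_left mult_ac)
  show ?thesis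
    unfolding square2_def raise2 sum_frame2 by (simp add: power2_eq_square mult_ac)
qed

section \<open>The dual in frame components\<close>

lemma levi_civita_contract:
  "(\<Sum>d\<in>UNIV. \<Sum>e\<in>UNIV. \<Sum>f\<in>UNIV. levi_civita x a b c d e f * T d e f) =
    - (\<Sum>p | p permutes (UNIV :: 6 set). of_int (sign p) *
      (x (p 0) $ a * (x (p 1) $ b * (x (p 2) $ c * comp3 x T (p 3) (p 4) (p 5)))))"
  unfolding levi_civita_def comp3_def comp2_def frame_comp_def contract_def sum_distrib_left sum_distrib_right
    sum_negf mult_minus_left
  by (subst sum_swap_31) (simp add: mult_ac)

text \<open>Makes \<open>levi_civita_contract\<close> applicable to \<open>hodge\<close>, whose
  \<open>eps\<close> is built on the standard basis.\<close>

lemma comp3_axis: "comp3 (\<lambda>a. axis a 1) T = T"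
proof -
  have "frame_comp (\<lambda>a. axis a 1) w = w" for w
    by (simp add: frame_comp_def contract_def axis_def fun_eq_iff if_distrib[of "\<lambda>x. x * _"] cong: if_cong)
  then show ?thesis by (simp add: comp3_def comp2_def fun_eq_iff)
qed

text \<open>Both sides are the same sum over permutations. Lowering \<open>e (p i)\<close> with
  \<open>g\<close> and evaluating on \<open>e a\<close> gives \<open>minkowski a (p i)\<close> by
  orthonormality, while the slots contracted with \<open>T\<close> give its frame
  components.\<close>

lemma comp3_dual:
  assumes "orthonormal_frame g e"
  shows "comp3 e (dual g e T) = hodge (comp3 e T)"
proof (intro ext)
  fix a b c
  define G where "G = (\<lambda>\<mu> \<alpha>. g $ \<mu> $ \<alpha>)"
  define k where "k p = - (1 / 6) * of_int (sign p) * comp3 e T (p 3) (p 4) (p 5)" for p :: "6 \<Rightarrow> 6"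
  have "dual_up e T \<alpha> \<beta> \<gamma> = (\<Sum>p | p permutes (UNIV :: 6 set).
      k p * (e (p 0) $ \<alpha> * (e (p 1) $ \<beta> * e (p 2) $ \<gamma>)))" for \<alpha> \<beta> \<gamma>
    unfolding dual_up_def levi_civita_contract k_def
    by (simp add: sum_distrib_left fact_numeral mult_ac flip: sum_negf)
  then have "dual g e T \<mu> \<nu> \<rho> = contract G (\<lambda>\<alpha>. contract G (\<lambda>\<beta>. contract G (\<lambda>\<gamma>. \<Sum>p | p permutes (UNIV :: 6 set).
      k p * (e (p 0) $ \<alpha> * (e (p 1) $ \<beta> * e (p 2) $ \<gamma>))) \<rho>) \<nu>) \<mu>" for \<mu> \<nu> \<rho>
    by (simp add: dual_def lower3_def contract_def G_def sum_distrib_left mult.assoc)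
  also have "\<dots> \<mu> \<nu> \<rho> = (\<Sum>p | p permutes (UNIV :: 6 set).
      k p * (contract G (\<lambda>\<gamma>. e (p 2) $ \<gamma>) \<rho> * (contract G (\<lambda>\<beta>. e (p 1) $ \<beta>) \<nu> * contract G (\<lambda>\<alpha>. e (p 0) $ \<alpha>) \<mu>)))" for \<mu> \<nu> \<rho>
    unfolding contract_sum contract_cmult
    by (simp add: contract_cmult mult.commute[of "e _ $ _"] mult.assoc)
  finally have dual: "dual g e T = (\<lambda>\<mu> \<nu> \<rho>. \<Sum>p | p permutes (UNIV :: 6 set).
      k p * (contract G (\<lambda>\<alpha>. e (p 0) $ \<alpha>) \<mu> * (contract G (\<lambda>\<beta>. e (p 1) $ \<beta>) \<nu> * contract G (\<lambda>\<gamma>. e (p 2) $ \<gamma>) \<rho>)))"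
    by (simp add: fun_eq_iff mult_ac)
  have G: "frame_comp e (\<lambda>\<mu>. contract G (\<lambda>\<alpha>. e b $ \<alpha>) \<mu>) a = minkowski a b" for a b
    using assms
    by (simp add: orthonormal_frame_def inner_g_def frame_comp_def contract_def G_def sum_distrib_left mult_ac)
  \<comment> \<open>\<open>minkowski\<close> is \<open>eta\<close> times a Kronecker delta, and the
    delta is a component of a standard basis vector, which is how it enters
    \<open>eps\<close>.\<close>
  have delta: "minkowski a (p 0) * (minkowski b (p 1) * minkowski c (p 2)) =
      eta a * eta b * eta c * (axis (p 0) 1 $ a * (axis (p 1) 1 $ b * axis (p 2) 1 $ c))" for p :: "6 \<Rightarrow> 6"
    by (simp add: minkowski_def axis_def)
  have "comp3 e (dual g e T) a b c = (\<Sum>p | p permutes (UNIV :: 6 set).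
      k p * (minkowski a (p 0) * (minkowski b (p 1) * minkowski c (p 2))))"
    unfolding comp3_def comp2_def dual frame_comp_sum frame_comp_cmult G
    by (simp add: frame_comp_cmult G mult.commute[of "contract _ _ _"] mult_ac)
  also have "\<dots> = hodge (comp3 e T) a b c"
    unfolding delta hodge_def eps_def levi_civita_contract comp3_axis k_def
    by (simp add: sum_distrib_left mult_ac flip: sum_negf)
  finally show "comp3 e (dual g e T) a b c = hodge (comp3 e T) a b c" .
qed

section \<open>Frames adapted to a timelike vector\<close>

lemma inner_g_linear:
  "inner_g g (x + y) z = inner_g g x z + inner_g g y z"
  "inner_g g (x - y) z = inner_g g x z - inner_g g y z"
  "inner_g g (k *\<^sub>R x) z = k * inner_g g x z"
  "inner_g g (- x) z = - inner_g g x z"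
  "inner_g g z (x + y) = inner_g g z x + inner_g g z y"
  "inner_g g z (x - y) = inner_g g z x - inner_g g z y"
  "inner_g g z (k *\<^sub>R x) = k * inner_g g z x"
  "inner_g g z (- x) = - inner_g g z x"
  by (simp_all add: inner_g_def algebra_simps sum.distrib sum_subtractf sum_negf sum_distrib_left)

lemma inner_g_commute:
  assumes "transpose g = g"
  shows "inner_g g x y = inner_g g y x"
proof -
  have "g $ i $ j = g $ j $ i" for i j
    using arg_cong[OF assms, of "\<lambda>A. A $ j $ i"] by (simp add: transpose_def)
  then show ?thesis
    unfolding inner_g_def by (subst sum.swap) (simp add: mult_ac)
qed

text \<open>A reflection is an isometry and so preserves orthonormality of the given frame; one is
  chosen that sends \<open>e 0\<close> to \<open>v\<close> up to sign.\<close>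

lemma exists_orthonormal_frame_extending:
  assumes g: "transpose g = g" and e: "orthonormal_frame g e" and v: "inner_g g v v = -1"
  shows "\<exists>e'. orthonormal_frame g e' \<and> e' 0 = v"
proof -
  note [simp] = inner_g_linear and sym = inner_g_commute[OF g]
  have ee: "inner_g g (e a) (e b) = minkowski a b" for a b
    using e by (simp add: orthonormal_frame_def)
  define s :: real where "s = (if inner_g g v (e 0) \<ge> 0 then 1 else -1)"
  have s: "s * s = 1" "s * inner_g g v (e 0) \<ge> 0"
    by (simp_all add: s_def)
  \<comment> \<open>\<open>R\<close> is the reflection exchanging \<open>v\<close> and \<open>s e\<^sub>0\<close>; the sign \<open>s\<close> makes \<open>v - s e\<^sub>0\<close> non-null.\<close>
  define n where "n = v - s *\<^sub>R e 0"
  define R where "R x = x - (2 * inner_g g x n / inner_g g n n) *\<^sub>R n" for x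
  \<comment> \<open>Both \<open>v\<close> and \<open>s e 0\<close> have square -1, and by the choice
    of \<open>s\<close> the cross term is not positive, so this is at most -2.\<close>
  have nn: "inner_g g n n = - 2 - 2 * (s * inner_g g v (e 0))"
    by (simp add: n_def v ee minkowski_def sym[of "e 0" v] s(1) algebra_simps)
  then have nn0: "inner_g g n n \<noteq> 0"
    using s(2) by linarith
  have RR: "inner_g g (R x) (R y) = inner_g g x y" for x y
    using nn0 by (simp add: R_def sym[of n y] field_simps)
  have "2 * inner_g g (s *\<^sub>R e 0) n = - inner_g g n n"
    unfolding nn by (simp add: n_def ee minkowski_def sym[of "e 0" v] s(1) algebra_simps)
  then have "2 * inner_g g (s *\<^sub>R e 0) n / inner_g g n n = -1"
    using nn0 by (subst divide_eq_minus_1_iff) blast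
  then have Rv: "R (s *\<^sub>R e 0) = v"
    unfolding R_def by (simp only:) (simp add: n_def)
  have vR: "inner_g g v (R x) = s * inner_g g (e 0) x" for x
    using RR[of "s *\<^sub>R e 0" x] unfolding Rv by simp
  \<comment> \<open>As \<open>v\<close> is \<open>s\<close> times \<open>R (e 0)\<close>, this
    differs from the reflected frame at most by the sign of vector 0.\<close>
  define e' where "e' a = (if a = 0 then v else R (e a))" for a
  have "inner_g g (e' a) (e' b) = minkowski a b" for a b
    by (auto simp: e'_def v vR sym[of "R _" v] RR ee) (simp_all add: minkowski_def)
  then show ?thesis
    unfolding orthonormal_frame_def by (intro exI[of _ e']) (simp add: e'_def)
qed

text \<open>The two frames differ by a matrix of determinant 1. In the determinant form of
  \<open>levi_civita\<close> it multiplies the row-selected frame matrix from the right, leaving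
  every component unchanged.\<close>

lemma levi_civita_cong:
  assumes "det (frame_matrix e') = det (frame_matrix e)" "det (frame_matrix e) \<noteq> 0"
  shows "levi_civita e' = levi_civita e"
proof (intro ext)
  fix a b c d f h
  let ?E = "transpose (frame_matrix e)" and ?E' = "transpose (frame_matrix e')"
  obtain J where J: "?E ** J = mat 1"
    using assms(2) by (metis det_transpose invertible_det_nz invertible_right_inverse)
  have det_JE: "det (J ** ?E') = 1"
    using arg_cong[OF J, of det] assms by (simp add: det_mul mult.commute)
  let ?N = "\<lambda>x :: 6 \<Rightarrow> real^6. \<chi> i j. x j $ index6 a b c d f h i"
  have E': "?E ** (J ** ?E') = ?E'"
    by (simp add: matrix_mul_assoc J)
  have "(?N e ** Z) $ i $ j = (?E ** Z) $ index6 a b c d f h i $ j" for i j and Z :: "real^6^6"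
    by (simp add: matrix_matrix_mult_def transpose_def)
  moreover have "?N e' $ i $ j = (?E ** (J ** ?E')) $ index6 a b c d f h i $ j" for i j
    unfolding E' by (simp add: transpose_def)
  ultimately have "?N e' $ i $ j = (?N e ** (J ** ?E')) $ i $ j" for i j
    by metis
  then have "?N e' = ?N e ** (J ** ?E')"
    by (simp add: vec_eq_iff)
  then have "det (?N e') = det (?N e)"
    using det_JE by (simp add: det_mul)
  then show "levi_civita e' a b c d f h = levi_civita e a b c d f h"
    by (simp add: levi_civita_det)
qed

text \<open>Orthonormal frames of \<open>g\<close> have equal determinants up to sign. If the sign
  is wrong, reversing the spatial vector \<open>u 5\<close> corrects it and keeps
  \<open>u 0 = v\<close>.\<close>

lemma exists_oriented_frame_extending:
  assumes g: "oriented_lorentzian g e" and v: "inner_g g v v = -1"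
  shows "\<exists>e'. orthonormal_frame g e' \<and> e' 0 = v \<and> levi_civita e' = levi_civita e"
proof -
  have gt: "transpose g = g" and e: "orthonormal_frame g e"
    using g by (auto simp: oriented_lorentzian_def)
  obtain u where u: "orthonormal_frame g u" "u 0 = v"
    using exists_orthonormal_frame_extending[OF gt e v] by blast
  have "(det (frame_matrix u))\<^sup>2 = (det (frame_matrix e))\<^sup>2"
    using orthonormal_frame_det(1)[OF e] orthonormal_frame_det(1)[OF u(1)] orthonormal_frame_det(3)[OF e]
    by (metis mult_right_cancel)
  then consider "det (frame_matrix u) = det (frame_matrix e)" | "det (frame_matrix u) = - det (frame_matrix e)"
    using power2_eq_iff by blast
  then show ?thesis
  proof cases
    case 1
    then show ?thesis
      using u levi_civita_cong[OF _ orthonormal_frame_det(2)[OF e]] by blast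
  next
    case 2
    define w where "w = u(5 := - u 5)"
    have "orthonormal_frame g w"
      using u(1) unfolding orthonormal_frame_def
      by (auto simp: w_def inner_g_linear minkowski_def)
    moreover have "w 0 = v"
      using u(2) by (simp add: w_def)
    moreover have "frame_matrix w = (\<chi> i. if i = 5 then (-1) *s u i else u i)"
      by (simp add: w_def vec_eq_iff)
    then have "det (frame_matrix w) = - det (\<chi> i. if i = 5 then u i else u i)"
      by (simp only: det_row_mul)
    then have "det (frame_matrix w) = det (frame_matrix e)"
      using 2 by simp
    ultimately show ?thesis
      using levi_civita_cong[OF _ orthonormal_frame_det(2)[OF e]] by blast
  qed
qed

section \<open>Reconstruction from the electric part\<close>

lemma hodge_hodge:
  assumes "three_form T"
  shows "hodge (hodge T) = T"
  by (rule three_form_eqI[OF three_form_hodge assms])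
    (simp_all add: hodge_components[OF three_form_hodge] hodge_components[OF assms])

lemma hodge_linear:
  "hodge (\<lambda>a b c. S a b c + T a b c) a b c = hodge S a b c + hodge T a b c"
  "hodge (\<lambda>a b c. k * S a b c) a b c = k * hodge S a b c"
  by (simp_all add: hodge_def sum.distrib distrib_left sum_distrib_left sum_divide_distrib mult_ac)

lemma three_form_linear:
  "three_form S \<Longrightarrow> three_form T \<Longrightarrow> three_form (\<lambda>a b c. S a b c + T a b c)"
  "three_form S \<Longrightarrow> three_form (\<lambda>a b c. k * S a b c)"
  unfolding three_form_def by (metis minus_add_distrib, metis mult_minus_right)

text \<open>\<open>hodge\<close> exchanges the components containing index 0 with the purely spatial
  ones, so in an eigenform the latter are \<open>s\<close> times the former. It is applied with
  \<open>s\<close> equal to 1 and -1.\<close>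

lemma hodge_eigenform_eqI:
  assumes S: "three_form S" "hodge S = (\<lambda>a b c. s * S a b c)"
    and T: "three_form T" "hodge T = (\<lambda>a b c. s * T a b c)"
    and electric: "\<And>a b. S a b 0 = T a b 0"
  shows "S = T"
proof -
  have rot: "R 0 a b = R a b 0" if "three_form R" for R :: tensor3 and a b
    using that unfolding three_form_def by metis
  have el: "S 0 a b = T 0 a b" for a b
    using electric[of a b] rot[OF S(1)] rot[OF T(1)] by simp
  show ?thesis
    using hodge_components[OF S(1), unfolded S(2)] hodge_components[OF T(1), unfolded T(2)]
    by (intro three_form_eqI[OF S(1) T(1)]) (simp_all add: el)
qed

text \<open>The first two claims of the theorem, read in a frame whose vector 0 is \<open>v\<close>;
  the number \<open>k\<close> stands for 24 V_I.\<close>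

lemma self_duality_from_electric_part:
  assumes F: "three_form F" and L: "three_form L" "hodge L = L"
    and B: "\<And>a b. hodge F a b 0 = - L a b 0 - k *
      (4 * (\<Sum>c\<in>UNIV. \<Sum>d\<in>UNIV. eta c * eta d * (L a c 0 * L c d 0 * L d b 0))
       + L a b 0 * (\<Sum>c\<in>UNIV. \<Sum>d\<in>UNIV. eta c * eta d * (L c d 0)\<^sup>2))"
    and E: "\<And>a b. F a b 0 = - hodge F a b 0 - 2 * L a b 0"
  shows "L a b c = - (1 / 2 * (F a b c + hodge F a b c))"
    and "1 / 2 * (F a b c - hodge F a b c) = k * LM L a b c"
proof -
  note lin = three_form_linear three_form_hodge F L(1) LM_self_dual(1)[OF L]
  have "L = (\<lambda>a b c. - (1 / 2) * (F a b c + hodge F a b c))"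
  proof (rule hodge_eigenform_eqI[where s = 1])
    show "L a b 0 = - (1 / 2) * (F a b 0 + hodge F a b 0)" for a b
      using E[of a b] by simp
    show "hodge (\<lambda>a b c. - (1 / 2) * (F a b c + hodge F a b c)) =
        (\<lambda>a b c. 1 * (- (1 / 2) * (F a b c + hodge F a b c)))"
      by (intro ext, simp only: hodge_linear hodge_hodge[OF F], simp?)
  qed (intro lin | simp add: L(2))+
  then show "L a b c = - (1 / 2 * (F a b c + hodge F a b c))"
    by (simp add: fun_eq_iff)
  have "(\<lambda>a b c. 1 / 2 * (F a b c + - 1 * hodge F a b c)) = (\<lambda>a b c. k * LM L a b c)"
  proof (rule hodge_eigenform_eqI[where s = "-1"])
    \<comment> \<open>By \<open>E\<close> the left side is \<open>- hodge F a b 0 - L a b 0\<close>,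
      and by \<open>B\<close> this is \<open>k\<close> times the bracket.\<close>
    show "1 / 2 * (F a b 0 + - 1 * hodge F a b 0) = k * LM L a b 0" for a b
      unfolding LM_self_dual(3)[OF L] using E[of a b] B[of a b] by argo
    show "hodge (\<lambda>a b c. 1 / 2 * (F a b c + - 1 * hodge F a b c)) =
        (\<lambda>a b c. - 1 * (1 / 2 * (F a b c + - 1 * hodge F a b c)))"
      by (intro ext, simp only: hodge_linear hodge_hodge[OF F], simp?)
    show "hodge (\<lambda>a b c. k * LM L a b c) = (\<lambda>a b c. - 1 * (k * LM L a b c))"
      by (intro ext, simp only: hodge_linear LM_self_dual(2)[OF L], simp?)
  qed (intro lin)+
  then show "1 / 2 * (F a b c - hodge F a b c) = k * LM L a b c"
    by (simp add: fun_eq_iff)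
qed

section \<open>Transfer from the adapted frame to the given basis\<close>

theorem mainTheorem8:
  fixes g :: "real^6^6" and e :: "6 \<Rightarrow> real^6" and v :: "real^6"
    and F L :: tensor3 and E B l :: tensor2
    and V :: "real \<Rightarrow> real" and U :: "real set"
  assumes "oriented_lorentzian g e"
    and "inner_g g v v = -1"
    and "three_form F"
    and "three_form L"
    and "L = dual g e L"
    and "open U" and "V differentiable_on U" and "I_inv g L \<in> U"
    and "E = contract_v F v"
    and "B = contract_v (dual g e F) v"
    and "l = contract_v L v"
    and "\<forall>\<mu> \<nu>. B \<mu> \<nu> =
           - l \<mu> \<nu> - 24 * deriv V (I_inv g L) * (4 * cube2 g l \<mu> \<nu> + l \<mu> \<nu> * square2 g l)"
    and "\<forall>\<mu> \<nu>. E \<mu> \<nu> = - B \<mu> \<nu> - 2 * l \<mu> \<nu>"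
  shows "(\<forall>\<mu> \<nu> \<rho>. L \<mu> \<nu> \<rho> = - plus_part g e F \<mu> \<nu> \<rho>)
    \<and> (\<forall>\<mu> \<nu> \<rho>. raise3 g (minus_part g e F) \<mu> \<nu> \<rho> =
          24 * deriv V (I_inv g L) * (\<Sum>\<sigma>\<in>UNIV. raise3_12 g L \<mu> \<nu> \<sigma> * M_up g L \<sigma> \<rho>))
    \<and> (\<forall>\<mu> \<nu> \<rho>. raise3 g (minus_part g e F) \<mu> \<nu> \<rho> =
          - 24 * deriv V (I_inv g (plus_part g e F)) *
            (\<Sum>\<sigma>\<in>UNIV. raise3_12 g (plus_part g e F) \<mu> \<nu> \<sigma> * M_up g (plus_part g e F) \<sigma> \<rho>))"
proof -
  \<comment> \<open>In \<open>x\<close> the vector \<open>v\<close> has index 0, and equality of the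
    Levi-Civita tensors allows duals to be computed with \<open>x\<close> instead of
    \<open>e\<close>.\<close>
  obtain x where x: "orthonormal_frame g x" "x 0 = v" and levi: "levi_civita x = levi_civita e"
    using exists_oriented_frame_extending[OF assms(1,2)] by blast
  have dual: "dual g e T = dual g x T" for T
    by (simp add: dual_def dual_up_def[abs_def] levi)
  define k where "k = 24 * deriv V (I_inv g L)"
  define L' where "L' = comp3 x L"
  define F' where "F' = comp3 x F"
  have F': "three_form F'" and L': "three_form L'"
    using assms(3,4) by (simp_all add: F'_def L'_def three_form_comp3)
  have sd: "hodge L' = L'"
    unfolding L'_def using comp3_dual[OF x(1), of L] assms(5) dual by metis
  have hF: "comp3 x (dual g e F) = hodge F'"
    by (simp add: F'_def dual comp3_dual[OF x(1)])
  have l: "comp2 x l a b = L' a b 0" and E: "comp2 x E a b = F' a b 0"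
    and B: "comp2 x B a b = hodge F' a b 0" for a b
    by (simp_all add: assms(9-11) L'_def F'_def hF[symmetric] comp2_contract_v flip: x(2) F'_def)
  \<comment> \<open>A linear combination of tensors, with the scalar \<open>square2\<close> among
    the coefficients, so that frame components can be taken term by term.\<close>
  have "B = (\<lambda>\<mu> \<nu>. (- 1) * l \<mu> \<nu> + (- 4 * k) * cube2 g l \<mu> \<nu> + (- k * square2 g l) * l \<mu> \<nu>)"
    using assms(12) by (simp add: k_def fun_eq_iff algebra_simps)
  then have comp_B: "comp2 x B a b = - comp2 x l a b - 4 * k * comp2 x (cube2 g l) a b - k * square2 g l * comp2 x l a b" for a b
    by (simp only: comp2_add comp2_cmult, simp?)
  have magnetic: "hodge F' a b 0 = - L' a b 0 - k *
      (4 * (\<Sum>c\<in>UNIV. \<Sum>d\<in>UNIV. eta c * eta d * (L' a c 0 * L' c d 0 * L' d b 0))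
       + L' a b 0 * (\<Sum>c\<in>UNIV. \<Sum>d\<in>UNIV. eta c * eta d * (L' c d 0)\<^sup>2))" for a b
  proof -
    have "y = - m - k * (4 * S + m * Q)" if "y = - m - 4 * k * S - k * Q * m" for y m S Q
      using that by (simp add: algebra_simps)
    then show ?thesis
      using comp_B[of a b] unfolding cube2_frame[OF x(1)] square2_frame[OF x(1)] l B by blast
  qed
  have "E = (\<lambda>\<mu> \<nu>. (- 1) * B \<mu> \<nu> + (- 2) * l \<mu> \<nu>)"
    using assms(13) by (simp add: fun_eq_iff)
  then have "comp2 x E a b = - comp2 x B a b - 2 * comp2 x l a b" for a b
    by (simp only: comp2_add comp2_cmult, simp?)
  then have electric: "F' a b 0 = - hodge F' a b 0 - 2 * L' a b 0" for a b
    unfolding l B E .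
  note flat = self_duality_from_electric_part[OF F' L' sd magnetic electric]

  have plus: "plus_part g e F = (\<lambda>\<mu> \<nu> \<rho>. (1 / 2) * (F \<mu> \<nu> \<rho> + dual g e F \<mu> \<nu> \<rho>))"
    and minus: "minus_part g e F = (\<lambda>\<mu> \<nu> \<rho>. (1 / 2) * (F \<mu> \<nu> \<rho> + (- 1) * dual g e F \<mu> \<nu> \<rho>))"
    by (simp_all add: plus_part_def minus_part_def fun_eq_iff)
  have "comp3 x L = comp3 x (\<lambda>\<mu> \<nu> \<rho>. - plus_part g e F \<mu> \<nu> \<rho>)"
    using flat(1) unfolding fun_eq_iff plus comp3_lin hF F'_def[symmetric] L'_def[symmetric] by simp
  then have L_plus: "L = (\<lambda>\<mu> \<nu> \<rho>. - plus_part g e F \<mu> \<nu> \<rho>)"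
    by (rule comp3_inject[OF orthonormal_frame_det(2)[OF x(1)]])
  have "comp3 x (minus_part g e F) a b c = k * LM (comp3 x L) a b c" for a b c
    using flat(2) unfolding minus comp3_lin hF F'_def[symmetric] L'_def[symmetric] by simp
  then have minus_L: "raise3 g (minus_part g e F) \<mu> \<nu> \<rho> =
      k * (\<Sum>\<sigma>\<in>UNIV. raise3_12 g L \<mu> \<nu> \<sigma> * M_up g L \<sigma> \<rho>)" for \<mu> \<nu> \<rho>
    unfolding raise3_frame[OF x(1)] L_M_up_frame[OF x(1)]
    by (simp add: sum_distrib_left mult_ac)
  let ?P = "plus_part g e F"
  \<comment> \<open>\<open>M\<close> is quadratic and \<open>I\<close> quartic in the three-form, so
    both ignore the sign in L = -F^+; the one remaining factor \<open>L\<close> produces the minus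
    sign of the final condition.\<close>
  have L_even: "M_up g L = M_up g ?P" "I_inv g L = I_inv g ?P"
    and L_odd: "raise3_12 g L \<mu> \<nu> \<sigma> = - raise3_12 g ?P \<mu> \<nu> \<sigma>" for \<mu> \<nu> \<sigma>
  proof -
    have "M_mixed g L = M_mixed g ?P"
      by (simp add: L_plus M_mixed_def raise3_def sum_negf fun_eq_iff)
    then show "M_up g L = M_up g ?P" "I_inv g L = I_inv g ?P"
      by (simp_all add: M_up_def I_inv_def)
    show "raise3_12 g L \<mu> \<nu> \<sigma> = - raise3_12 g ?P \<mu> \<nu> \<sigma>"
      by (simp add: L_plus raise3_12_def sum_negf)
  qed
  have "raise3 g (minus_part g e F) \<mu> \<nu> \<rho> = - 24 * deriv V (I_inv g ?P) *
      (\<Sum>\<sigma>\<in>UNIV. raise3_12 g ?P \<mu> \<nu> \<sigma> * M_up g ?P \<sigma> \<rho>)" for \<mu> \<nu> \<rho>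
    unfolding minus_L k_def L_even L_odd by (simp add: sum_negf)
  then show ?thesis
    using minus_L L_plus unfolding k_def by metis
qed

end
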